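(* Let $G$ be an infinite abelian group, and let $C$ be a finite non-empty solid subset of $G$. Then $C$ is a maximal supplement in $G$.
   Context: For subsets $A,B$ of an abelian group $G$, $A-B=\{a-b : a\in A, b\in B\}$. A subset $C \subseteq G$ is a supplement for $W \subseteq G$ if the translates $c + W$, $c \in C$, are pairwise disjoint; it is a maximal supplement for $W$ if moreover no proper superset of $C$ is a supplement for $W$. $C$ is a maximal supplement in $G$ if it is a maximal supplement for some $W \subseteq G$. A subset $C \subseteq G$ is solid if there is no set $D \supsetneq C$ with $D - D = C - C$. *)

theory Defs
  imports "HOL-Library.Disjoint_Sets"
begin

(* The ambient abelian group G is the whole type 'a :: ab_group_add. *)

(* The difference set {a - b}; note that A - B on sets is the complement of B in A. *)
definition diff_set :: "'a::ab_group_add set \<Rightarrow> 'a set \<Rightarrow> 'a set" where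
  "diff_set A B = {a - b | a b. a \<in> A \<and> b \<in> B}"

(* Disjointness is for the family indexed by C: distinct c, c' in C must give disjoint
   translates, so equal nonempty translates for distinct c, c' are not allowed. *)
definition supplement :: "'a::ab_group_add set \<Rightarrow> 'a set \<Rightarrow> bool" where
  "supplement W C \<longleftrightarrow> disjoint_family_on (\<lambda>c. (\<lambda>w. c + w) ` W) C"

definition maximal_supplement_for :: "'a::ab_group_add set \<Rightarrow> 'a set \<Rightarrow> bool" where
  "maximal_supplement_for W C \<longleftrightarrow> supplement W C \<and> \<not> (\<exists>D. C \<subset> D \<and> supplement W D)"

definition maximal_supplement :: "'a::ab_group_add set \<Rightarrow> bool" where
  "maximal_supplement C \<longleftrightarrow> (\<exists>W. maximal_supplement_for W C)"

definition solid :: "'a::ab_group_add set \<Rightarrow> bool" where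
  "solid C \<longleftrightarrow> \<not> (\<exists>D. C \<subset> D \<and> diff_set D D = diff_set C C)"

end

(* Since C is finite, so is F = C - C, and solidity says that every d outside C has some
   d - c outside F. So it suffices to find W such that W - W meets F only in 0 and contains
   every g outside F. Enumerate the group along a well-order of minimal type and choose, for
   each g, a pair {x g, x g + g} whose differences with the earlier pairs avoid F: at each
   stage fewer than |G| values of x g are forbidden. *)

theory Submission
  imports Defs
begin

unbundle cardinal_syntax

lemma card_of_finite_ordLess_infinite:
  assumes "finite A" "infinite B"
  shows "|A| <o |B|"
  using finite_ordLess_infinite[OF card_of_Well_order card_of_Well_order, of A B] assms
  by (simp add: Field_card_of)

text \<open>Every proper initial segment of a cardinal order is smaller than the whole. If it is
  infinite, a union of finite sets over it is no larger than the segment; if it is finite, so is the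
  union.\<close>

lemma card_UN_finite_underS_less:
  fixes B :: "'a \<Rightarrow> 'b set" and g :: 'a
  assumes inf: "infinite (UNIV :: 'b set)"
    and le: "|UNIV :: 'a set| \<le>o |UNIV :: 'b set|"
    and fin: "\<And>h. finite (B h)"
  shows "|\<Union>h\<in>underS |UNIV :: 'a set| g. B h| <o |UNIV :: 'b set|"
proof (cases "finite (underS |UNIV :: 'a set| g)")
  case True
  with fin have "finite (\<Union>h\<in>underS |UNIV :: 'a set| g. B h)" by blast
  with inf show ?thesis by (simp add: card_of_finite_ordLess_infinite)
next
  case False
  let ?S = "underS |UNIV :: 'a set| g"
  have "|B h| \<le>o |?S|" for h
    using False fin[of h] by (simp add: card_of_finite_ordLess_infinite ordLess_imp_ordLeq)
  hence "|\<Union>h\<in>?S. B h| \<le>o |?S|"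
    using False by (intro card_of_UNION_ordLeq_infinite card_of_mono1) auto
  also have "|?S| <o |UNIV :: 'a set|"
    using card_of_Card_order by (rule card_of_underS) (simp add: Field_card_of)
  finally show ?thesis using le by (rule ordLess_ordLeq_trans)
qed

text \<open>Read \<open>E g h y\<close> as the values barred at index \<open>g\<close> once index
  \<open>h\<close> has value \<open>y\<close>. Recursion along the cardinal order lets each index
  avoid what earlier indices bar; the disjunction appears because either of \<open>g\<close> and
  \<open>h\<close> may be the later one.\<close>

lemma selection_avoiding_finite_conflicts:
  fixes E :: "'a \<Rightarrow> 'a \<Rightarrow> 'b \<Rightarrow> 'b set"
  assumes inf: "infinite (UNIV :: 'b set)"
    and le: "|UNIV :: 'a set| \<le>o |UNIV :: 'b set|"
    and fin: "\<And>g h y. finite (E g h y)"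
  shows "\<exists>x. \<forall>g h. g \<noteq> h \<longrightarrow> x g \<notin> E g h (x h) \<or> x h \<notin> E h g (x g)"
proof -
  let ?r = "|UNIV :: 'a set|"
  have wo: "Well_order ?r" by (rule card_of_Well_order)
  have wf: "wf (?r - Id)"
    using wo by (simp add: well_order_on_def)
  have "\<exists>x. \<forall>g. \<forall>h\<in>underS ?r g. x g \<notin> E g h (x h)"
  \<comment> \<open>The recursion principle asks that the constraint at \<open>g\<close> depend only
    on values strictly below \<open>g\<close>, and that some value always meet it.\<close>
  proof (rule dependent_wf_choice[OF wf, where P = "\<lambda>x g y. \<forall>h\<in>underS ?r g. y \<notin> E g h (x h)"])
    fix x x' :: "'a \<Rightarrow> 'b" and g y
    assume "\<And>z. (z, g) \<in> ?r - Id \<Longrightarrow> x z = x' z"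
    thus "(\<forall>h\<in>underS ?r g. y \<notin> E g h (x h)) = (\<forall>h\<in>underS ?r g. y \<notin> E g h (x' h))"
      by (auto simp: underS_def)
  next
    fix g and x :: "'a \<Rightarrow> 'b"
    have "|\<Union>h\<in>underS ?r g. E g h (x h)| <o |UNIV :: 'b set|"
      using inf le fin by (rule card_UN_finite_underS_less)
    hence "(\<Union>h\<in>underS ?r g. E g h (x h)) \<noteq> UNIV"
      using ordLess_irreflexive[of "|UNIV :: 'b set|"] by auto
    thus "\<exists>y. \<forall>h\<in>underS ?r g. y \<notin> E g h (x h)" by blast
  qed
  then obtain x where x: "\<And>g h. h \<in> underS ?r g \<Longrightarrow> x g \<notin> E g h (x h)" by blast
  have "g \<in> underS ?r h \<or> h \<in> underS ?r g" if "g \<noteq> h" for g h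
    using wo that
    by (auto simp: well_order_on_def linear_order_on_def total_on_def underS_def Field_card_of)
  with x show ?thesis by blast
qed

lemma ex_set_prescribed_differences:
  fixes F :: "'a::ab_group_add set"
  assumes inf: "infinite (UNIV :: 'a set)"
    and fin: "finite F"
    and sym: "\<And>a. a \<in> F \<Longrightarrow> - a \<in> F"
  shows "\<exists>W. diff_set W W \<inter> F \<subseteq> {0} \<and> - F \<subseteq> diff_set W W"
proof -
  \<comment> \<open>These are the \<open>z\<close> for which some element of
    \<open>{z, z + g}\<close> minus some element of \<open>{y, y + h}\<close> lies in
    \<open>F\<close>: solve for \<open>z\<close>, with \<open>v\<close> the offset 0 or
    \<open>g\<close>.\<close>
  define E where "E g h y = (\<lambda>(u, v, a). u + a - v) ` ({y, y + h} \<times> {0, g} \<times> F)" for g h y :: 'a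
  have memE: "z \<in> E g h y" if "u \<in> {y, y + h}" "v \<in> {z, z + g}" "v - u \<in> F" for g h y z u v
  proof -
    have "z = u + (v - u) - (v - z)" "v - z \<in> {0, g}" using that by auto
    with that show ?thesis
      unfolding E_def by (intro image_eqI[where x = "(u, v - z, v - u)"]) auto
  qed
  have "finite (E g h y)" for g h y
    unfolding E_def using fin by simp
  with selection_avoiding_finite_conflicts[OF inf ordIso_imp_ordLeq[OF card_of_refl], of E]
  obtain x where x: "\<And>g h. g \<noteq> h \<Longrightarrow> x g \<notin> E g h (x h) \<or> x h \<notin> E h g (x g)"
    by blast
  \<comment> \<open>A nonzero \<open>g\<close> in \<open>F\<close> would put the forbidden
    difference \<open>g\<close> into the difference set, so only pairs for \<open>g\<close> outside
    \<open>F\<close> are kept.\<close>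
  define W where "W = (\<Union>g\<in>- F. {x g, x g + g})"
  have "v - u = 0" if "v \<in> W" "u \<in> W" "v - u \<in> F" for v u
  proof -
    from that obtain g h where gh: "g \<notin> F" "h \<notin> F" "v \<in> {x g, x g + g}" "u \<in> {x h, x h + h}"
      unfolding W_def by blast
    \<comment> \<open>Symmetry of \<open>F\<close> makes the conflict hold in both directions, which
      contradicts the selection whichever index came later.\<close>
    have "u - v \<in> F" using sym[OF that(3)] by simp
    hence "x g \<in> E g h (x h)" "x h \<in> E h g (x g)"
      using memE gh that(3) by blast+
    hence "g = h" using x by blast
    \<comment> \<open>Within one pair the differences are 0, \<open>g\<close> and
      \<open>- g\<close>, and only 0 can lie in \<open>F\<close>.\<close>
    moreover have "- g \<notin> F" using sym[of "- g"] gh by auto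
    ultimately show ?thesis using gh that(3) by auto
  qed
  hence "diff_set W W \<inter> F \<subseteq> {0}" by (auto simp: diff_set_def)
  moreover have "g \<in> diff_set W W" if "g \<notin> F" for g
  proof -
    have "x g + g \<in> W" "x g \<in> W" "g = (x g + g) - x g" using that by (auto simp: W_def)
    thus ?thesis unfolding diff_set_def by blast
  qed
  ultimately show ?thesis by blast
qed

lemma translates_disjoint_iff:
  fixes W :: "'a::ab_group_add set"
  shows "(\<lambda>w. c + w) ` W \<inter> (\<lambda>w. d + w) ` W = {} \<longleftrightarrow> d - c \<notin> diff_set W W"
proof -
  have "c + w = d + w' \<longleftrightarrow> d - c = w - w'" for w w'
  proof -
    \<comment> \<open>Subtracting \<open>c + w'\<close> leaves \<open>w - w'\<close> on the left and
      \<open>d - c\<close> on the right.\<close>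
    have "c + w = d + w' \<longleftrightarrow> (c + w) - (c + w') = (d + w') - (c + w')"
      by (simp only: diff_eq_eq diff_add_cancel)
    thus ?thesis by (simp only: add_diff_cancel_left add_diff_cancel_right eq_commute)
  qed
  thus ?thesis unfolding diff_set_def by blast
qed

lemma supplement_iff:
  "supplement W C \<longleftrightarrow> (\<forall>c\<in>C. \<forall>d\<in>C. c \<noteq> d \<longrightarrow> d - c \<notin> diff_set W W)"
  by (simp add: supplement_def disjoint_family_on_def translates_disjoint_iff)

text \<open>Otherwise adjoining \<open>d\<close> to \<open>C\<close> would create no new difference,
  as \<open>diff_set C C\<close> is symmetric and contains 0; this contradicts solidity.\<close>

lemma solid_ex_difference:
  assumes "solid C" "C \<noteq> {}" "d \<notin> C"
  shows "\<exists>c\<in>C. d - c \<notin> diff_set C C"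
proof (rule ccontr)
  assume "\<not> ?thesis"
  hence 1: "d - c \<in> diff_set C C" if "c \<in> C" for c using that by blast
  have 2: "c - d \<in> diff_set C C" if "c \<in> C" for c
  proof -
    from 1[OF that] obtain a b where "a \<in> C" "b \<in> C" "d - c = a - b"
      by (auto simp: diff_set_def)
    moreover from this have "c - d = b - a" by (metis minus_diff_eq)
    ultimately show ?thesis by (auto simp: diff_set_def)
  qed
  have 3: "d - d \<in> diff_set C C"
    using assms(2) by (auto simp: diff_set_def)
  have "diff_set (insert d C) (insert d C) \<subseteq> diff_set C C"
  proof
    fix z assume "z \<in> diff_set (insert d C) (insert d C)"
    then obtain a b where "z = a - b" "a \<in> insert d C" "b \<in> insert d C"
      unfolding diff_set_def by blast
    with 1 2 3 show "z \<in> diff_set C C" by (auto simp: diff_set_def)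
  qed
  hence "diff_set (insert d C) (insert d C) = diff_set C C"
    by (auto simp: diff_set_def)
  with assms show False unfolding solid_def by blast
qed

theorem theorem1p6:
  fixes C :: "'a::ab_group_add set"
  assumes "infinite (UNIV :: 'a set)"
    and "finite C"
    and "C \<noteq> {}"
    and "solid C"
  shows "maximal_supplement C"
proof -
  let ?F = "diff_set C C"
  have "?F = (\<lambda>(a, b). a - b) ` (C \<times> C)" by (auto simp: diff_set_def)
  hence "finite ?F" using assms(2) by simp
  moreover have "- a \<in> ?F" if "a \<in> ?F" for a
    using that unfolding diff_set_def using minus_diff_eq by blast
  ultimately obtain W where W: "diff_set W W \<inter> ?F \<subseteq> {0}" "- ?F \<subseteq> diff_set W W"
    using ex_set_prescribed_differences[OF assms(1)] by metis
  have "supplement W C"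
    unfolding supplement_iff
  proof (intro ballI impI notI)
    fix c d assume cd: "c \<in> C" "d \<in> C" "c \<noteq> d" "d - c \<in> diff_set W W"
    hence "d - c \<in> ?F" by (auto simp: diff_set_def)
    with cd W(1) have "d - c = 0" by blast
    with cd show False by simp
  qed
  \<comment> \<open>One new element \<open>d\<close> suffices: its translate already meets that of
    some \<open>c\<close> in \<open>C\<close>, because \<open>d - c\<close> lies outside
    \<open>?F\<close> and so is a difference of \<open>W\<close>.\<close>
  moreover have "\<not> supplement W D" if "C \<subset> D" for D
  proof -
    from that obtain d where "d \<in> D" "d \<notin> C" by blast
    with solid_ex_difference[OF assms(4,3)] obtain c where "c \<in> C" "d - c \<notin> ?F" by blast
    with W(2) have "d - c \<in> diff_set W W" by blast
    moreover have "c \<in> D" "c \<noteq> d" using \<open>c \<in> C\<close> \<open>d \<notin> C\<close> that by auto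
    ultimately show ?thesis using \<open>d \<in> D\<close> unfolding supplement_iff by blast
  qed
  ultimately show ?thesis
    unfolding maximal_supplement_def maximal_supplement_for_def by blast
qed

end
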